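(* Let $\Pi=\Pi_n$ be a prior on $S$ and $\eta_0\in S$ the true parameter. For any nonnegative sequence $\varepsilon_n$ and $0<\alpha_n<1$ such that $n\alpha_n\varepsilon_n^2\to\infty$ and $$\Pi(B_n(\eta_0,\varepsilon_n))\ge e^{-n\alpha_n\varepsilon_n^2},$$ there exists $C>0$ such that, as $n\to\infty$, $$\Pi_{\alpha_n}\Big(\eta:\ \frac1nD_{\alpha_n}(p^n_\eta,p^n_{\eta_0})\ge C\,\frac{\alpha_n\varepsilon_n^2}{1-\alpha_n}\ \Big|\ Y^n\Big)=o_P(1).$$
   Context: $(\mathcal Y^n,\mathcal A^n,P^n_\eta:\eta\in S)$ is a sequence of statistical experiments with observation $Y^n$ and densities $p^n_\eta$ with respect to a $\sigma$-finite measure $\mu^n$; $\ell_n(\eta)=\log p^n_\eta(Y^n)$; the data are drawn from $P_0=P^n_{\eta_0}$ and $o_P(1)$ is in $P_0$-probability. The $\alpha_n$-posterior is $\Pi_{\alpha_n}(B\mid Y^n)=\int_Be^{\alpha_n\ell_n}d\Pi/\int_Se^{\alpha_n\ell_n}d\Pi$. Rényi divergence of order $\alpha\in(0,1)$: $D_\alpha(f,g)=-\frac1{1-\alpha}\log\big(\int f^\alpha g^{1-\alpha}d\mu\big)$. Also $K(f,g)=\int f\log(f/g)\,d\mu$, $V(f,g)=\int f(\log(f/g)-K(f,g))^2d\mu$, and $B_n(\eta_0,\varepsilon)=\{\eta\in S:K(p^n_{\eta_0},p^n_\eta)\le n\varepsilon^2,\ V(p^n_{\eta_0},p^n_\eta)\le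 n\varepsilon^2\}$. *)

theory Defs
  imports "HOL-Probability.Probability"
begin

text \<open>
  The data are the identity map on the sample space \<open>space \<mu>\<close>, and the law with parameter \<open>\<eta>\<close> is
  \<open>density \<mu> (p \<eta>)\<close>.  Joint measurability is what makes integrals of the likelihood over the
  parameter, and hence the posterior, meaningful.
\<close>

locale dominated_experiment = sigma_finite_measure \<mu>
  for S :: "'s measure" and \<mu> :: "'y measure" and p :: "'s \<Rightarrow> 'y \<Rightarrow> real" +
  assumes joint_measurable: "(\<lambda>(\<eta>, y). p \<eta> y) \<in> borel_measurable (S \<Otimes>\<^sub>M \<mu>)"
    and density_nonneg: "\<And>\<eta> y. \<eta> \<in> space S \<Longrightarrow> y \<in> space \<mu> \<Longrightarrow> 0 \<le> p \<eta> y"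
    and density_total: "\<And>\<eta>. \<eta> \<in> space S \<Longrightarrow> (\<integral>\<^sup>+ y. ennreal (p \<eta> y) \<partial>\<mu>) = 1"

definition experiment_law :: "'y measure \<Rightarrow> ('s \<Rightarrow> 'y \<Rightarrow> real) \<Rightarrow> 's \<Rightarrow> 'y measure" where
  "experiment_law \<mu> p \<eta> = density \<mu> (\<lambda>y. ennreal (p \<eta> y))"

text \<open>
  Logarithm with values in the extended reals: \<open>log 0 = -\<infinity>\<close> and \<open>log \<infinity> = \<infinity>\<close> (whereas \<open>ln 0 = 0\<close>).
\<close>

definition ext_log :: "ereal \<Rightarrow> ereal" where
  "ext_log x = (if x \<le> 0 then -\<infinity> else if x = \<infinity> then \<infinity> else ereal (ln (real_of_ereal x)))"

text \<open>
  \<open>KL\<close>, \<open>KL_var\<close> and \<open>Renyi_div\<close> may be infinite, so they are extended-real valued; the library's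
  \<open>KL_divergence\<close> is real valued, with value \<open>0\<close> when the integral diverges or when absolute
  continuity fails.  The arithmetic of \<^typ>\<open>ereal\<close> (\<open>x / 0 = \<infinity>\<close> for \<open>x > 0\<close>, and \<open>0 * x = 0\<close>
  also for infinite \<open>x\<close>) gives the usual conventions for \<open>f log (f / g)\<close>: it is \<open>0\<close>
  where \<open>f = 0\<close>, and \<open>\<infinity>\<close> where \<open>f > 0 = g\<close>.
\<close>

definition log_ratio :: "('y \<Rightarrow> real) \<Rightarrow> ('y \<Rightarrow> real) \<Rightarrow> 'y \<Rightarrow> ereal" where
  "log_ratio f g y = ext_log (ereal (f y) / ereal (g y))"

text \<open>
  As \<open>e2ennreal\<close> sends negative values to \<open>0\<close>, the two integrals in \<open>KL\<close> are those of the
  positive and negative parts.  The integral of the negative part is finite for probability densities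
  (\<open>f log (g / f) \<le> g - f\<close>), so the difference is never \<open>\<infinity> - \<infinity>\<close>.
\<close>

definition KL :: "'y measure \<Rightarrow> ('y \<Rightarrow> real) \<Rightarrow> ('y \<Rightarrow> real) \<Rightarrow> ereal" where
  "KL \<mu> f g =
     enn2ereal (\<integral>\<^sup>+ y. e2ennreal (ereal (f y) * log_ratio f g y) \<partial>\<mu>)
     - enn2ereal (\<integral>\<^sup>+ y. e2ennreal (- (ereal (f y) * log_ratio f g y)) \<partial>\<mu>)"

definition KL_var :: "'y measure \<Rightarrow> ('y \<Rightarrow> real) \<Rightarrow> ('y \<Rightarrow> real) \<Rightarrow> ereal" where
  "KL_var \<mu> f g =
     enn2ereal (\<integral>\<^sup>+ y. e2ennreal (ereal (f y) * (log_ratio f g y - KL \<mu> f g)\<^sup>2) \<partial>\<mu>)"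

definition Renyi_div :: "real \<Rightarrow> 'y measure \<Rightarrow> ('y \<Rightarrow> real) \<Rightarrow> ('y \<Rightarrow> real) \<Rightarrow> ereal" where
  "Renyi_div \<alpha> \<mu> f g =
     - ereal (1 / (1 - \<alpha>)) *
       ext_log (enn2ereal (\<integral>\<^sup>+ y. ennreal (f y powr \<alpha> * g y powr (1 - \<alpha>)) \<partial>\<mu>))"

definition KL_nbhd ::
  "nat \<Rightarrow> 's measure \<Rightarrow> 'y measure \<Rightarrow> ('s \<Rightarrow> 'y \<Rightarrow> real) \<Rightarrow> 's \<Rightarrow> real \<Rightarrow> 's set" where
  "KL_nbhd n S \<mu> p \<eta>\<^sub>0 \<epsilon> =
     {\<eta> \<in> space S. KL \<mu> (p \<eta>\<^sub>0) (p \<eta>) \<le> ereal (real n * \<epsilon>\<^sup>2) \<and>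
                  KL_var \<mu> (p \<eta>\<^sub>0) (p \<eta>) \<le> ereal (real n * \<epsilon>\<^sup>2)}"

text \<open>
  \<open>p \<eta> y powr \<alpha>\<close> is \<open>exp (\<alpha> * log (p \<eta> y))\<close>, also where the density vanishes
  (\<open>0 powr \<alpha> = 0 = exp (-\<infinity>)\<close>).  For \<open>0 < \<alpha> < 1\<close> the denominator is finite almost surely under every law
  of the experiment.
\<close>

definition alpha_posterior ::
  "real \<Rightarrow> 's measure \<Rightarrow> ('s \<Rightarrow> 'y \<Rightarrow> real) \<Rightarrow> 'y \<Rightarrow> 's set \<Rightarrow> real" where
  "alpha_posterior \<alpha> prior p y B =
     enn2real ((\<integral>\<^sup>+ \<eta>\<in>B. ennreal (p \<eta> y powr \<alpha>) \<partial>prior) /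
               (\<integral>\<^sup>+ \<eta>. ennreal (p \<eta> y powr \<alpha>) \<partial>prior))"

definition little_o_P_1 :: "(nat \<Rightarrow> 'y measure) \<Rightarrow> (nat \<Rightarrow> 'y \<Rightarrow> real) \<Rightarrow> bool" where
  "little_o_P_1 P X \<longleftrightarrow>
     (\<forall>\<delta>>0. (\<lambda>n. measure (P n) {y \<in> space (P n). \<bar>X n y\<bar> > \<delta>}) \<longlonglongrightarrow> 0)"

end

theory Submission
  imports Defs "HOL-Real_Asymp.Real_Asymp"
begin

text \<open>
  Put \<open>m = n * \<epsilon>\<^sup>2\<close> and \<open>t = \<alpha> * m\<close>, and divide numerator and denominator of the posterior by
  \<open>p \<eta>\<^sub>0 y powr \<alpha>\<close>.  The Renyi divergence is \<open>- 1 / (1 - \<alpha>)\<close> times the logarithm of the mean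
  of \<open>(p \<eta> / p \<eta>\<^sub>0) powr \<alpha>\<close> under the true law; hence the numerator over \<open>D \<ge> 5 * t / (1 - \<alpha>)\<close> has
  mean at most \<open>exp (- 5 * t)\<close>, with no need for tests or entropy conditions.  By Chebyshev, for \<open>\<eta>\<close>
  in the Kullback-Leibler neighbourhood the ratio \<open>p \<eta> / p \<eta>\<^sub>0\<close> falls below \<open>exp (- 3 * m)\<close> with
  probability at most \<open>1 / (4 * m)\<close>, so with probability at least \<open>1 - 1 / (2 * m)\<close> half of the
  neighbourhood contributes to the denominator, which is then at least \<open>exp (- t) / 2 * exp (- 3 * t)\<close>.
\<close>

section \<open>Divergences between two fixed densities\<close>

text \<open>An integral bound is the form of a divergence bound that Tonelli's theorem can use. The
  extreme cases agree: a zero integral means divergence plus infinity, an infinite one minus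
  infinity.\<close>

lemma Renyi_div_ge_iff:
  assumes "\<alpha> < 1"
  shows "ereal c \<le> Renyi_div \<alpha> \<mu> f g \<longleftrightarrow>
    (\<integral>\<^sup>+ y. ennreal (f y powr \<alpha> * g y powr (1 - \<alpha>)) \<partial>\<mu>) \<le> ennreal (exp (- ((1 - \<alpha>) * c)))"
    (is "_ \<longleftrightarrow> ?H \<le> _")
proof (cases ?H)
  case (real h)
  show ?thesis
  proof (cases "h = 0")
    case True
    then show ?thesis
      using real assms by (simp add: Renyi_div_def ext_log_def zero_ennreal.rep_eq)
  next
    case False
    have "ereal c \<le> Renyi_div \<alpha> \<mu> f g \<longleftrightarrow> c \<le> - (ln h / (1 - \<alpha>))"
      using real False by (simp add: Renyi_div_def ext_log_def)
    also have "\<dots> \<longleftrightarrow> ln h \<le> - ((1 - \<alpha>) * c)"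
      using assms by (simp add: field_simps)
    also have "\<dots> \<longleftrightarrow> h \<le> exp (- ((1 - \<alpha>) * c))"
      using real False by (metis exp_le_cancel_iff exp_ln less_eq_real_def)
    finally show ?thesis
      using real by simp
  qed
next
  case top
  then show ?thesis
    using assms by (simp add: Renyi_div_def ext_log_def top_unique)
qed

lemma log_ratio_gt:
  assumes "0 \<le> g y" "g y < exp (- c) * f y"
  shows "ereal c < log_ratio f g y"
proof -
  \<comment> \<open>The strict bound forces \<open>f y > 0\<close>, so the quotient is never
    \<open>0 / 0\<close>, and it is infinite where \<open>g\<close> vanishes.\<close>
  have f: "0 < f y"
    using assms by (meson exp_gt_zero le_less_trans zero_less_mult_pos)
  show ?thesis
  proof (cases "g y = 0")
    case True
    then show ?thesis
      using f by (simp add: log_ratio_def ext_log_def)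
  next
    case False
    with assms have g: "0 < g y" by simp
    have "exp c < f y / g y"
      using assms(2) g by (simp add: exp_minus field_simps)
    then have "c < ln (f y / g y)"
      using f g by (metis divide_pos_pos exp_less_cancel_iff exp_ln)
    then show ?thesis
      using divide_pos_pos[OF f g] g by (auto simp: log_ratio_def ext_log_def not_le)
  qed
qed

text \<open>On the event the log ratio exceeds \<open>3 * m\<close> while its mean is at most
  \<open>m\<close>, so it deviates by at least \<open>2 * m\<close>; a variance of at most
  \<open>m\<close> leaves probability at most \<open>m / (2 * m)\<^sup>2\<close>.\<close>

lemma KL_var_Chebyshev:
  assumes [measurable]: "f \<in> borel_measurable \<mu>" "g \<in> borel_measurable \<mu>"
    and g: "\<And>y. y \<in> space \<mu> \<Longrightarrow> 0 \<le> g y"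
    and m: "0 < m" "KL \<mu> f g \<le> ereal m" "KL_var \<mu> f g \<le> ereal m"
  shows "(\<integral>\<^sup>+ y. ennreal (f y) * indicator {y. g y < exp (- (3 * m)) * f y} y \<partial>\<mu>)
           \<le> ennreal (1 / (4 * m))" (is "?I \<le> _")
proof -
  have le: "ennreal ((2 * m)\<^sup>2) * (ennreal (f y) * indicator {y. g y < exp (- (3 * m)) * f y} y)
      \<le> e2ennreal (ereal (f y) * (log_ratio f g y - KL \<mu> f g)\<^sup>2)" if "y \<in> space \<mu>" for y
  proof (cases "g y < exp (- (3 * m)) * f y")
    case True
    have f: "0 < f y"
      using True g[OF that] by (meson exp_gt_zero le_less_trans zero_less_mult_pos)
    \<comment> \<open>Infinite values do no harm: a log ratio of plus infinity or a divergence of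
      minus infinity makes the difference plus infinity.\<close>
    have "ereal (2 * m) \<le> log_ratio f g y - KL \<mu> f g"
      using log_ratio_gt[of g y "3 * m" f, OF g[OF that] True] m(2)
      by (cases "log_ratio f g y"; cases "KL \<mu> f g") auto
    then have "ereal ((2 * m)\<^sup>2) \<le> (log_ratio f g y - KL \<mu> f g)\<^sup>2"
      using m(1) power_mono[of "2 * m" _ 2] by (cases "log_ratio f g y - KL \<mu> f g") auto
    then have "ereal (f y) * ereal ((2 * m)\<^sup>2) \<le> ereal (f y) * (log_ratio f g y - KL \<mu> f g)\<^sup>2"
      using f by (intro ereal_mult_left_mono) auto
    then have "ennreal (f y * (2 * m)\<^sup>2) \<le> e2ennreal (ereal (f y) * (log_ratio f g y - KL \<mu> f g)\<^sup>2)"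
      using e2ennreal_mono by fastforce
    then show ?thesis
      using True f by (simp add: ennreal_mult mult.commute)
  qed simp
  have "ennreal ((2 * m)\<^sup>2) * ?I
      = (\<integral>\<^sup>+ y. ennreal ((2 * m)\<^sup>2) * (ennreal (f y) * indicator {y. g y < exp (- (3 * m)) * f y} y) \<partial>\<mu>)"
    by (rule nn_integral_cmult[symmetric]) measurable
  also have "\<dots> \<le> (\<integral>\<^sup>+ y. e2ennreal (ereal (f y) * (log_ratio f g y - KL \<mu> f g)\<^sup>2) \<partial>\<mu>)"
    by (intro nn_integral_mono le)
  also have "\<dots> \<le> ennreal m"
    using e2ennreal_mono[OF m(3)] by (simp add: KL_var_def)
  finally have *: "ennreal ((2 * m)\<^sup>2) * ?I \<le> ennreal m" .
  show ?thesis
  proof (cases ?I)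
    case (real r)
    have "ennreal ((2 * m)\<^sup>2 * r) \<le> ennreal m"
      using * real by (simp add: ennreal_mult)
    then have "(2 * m)\<^sup>2 * r \<le> m"
      using m(1) by (simp add: ennreal_le_iff)
    then have "r \<le> 1 / (4 * m)"
      using m(1) by (simp add: field_simps power2_eq_square)
    then show ?thesis
      using real by (simp add: ennreal_leI)
  next
    case top
    then show ?thesis
      using * m(1) by (simp add: ennreal_mult_top top_unique)
  qed
qed

section \<open>A single experiment with its prior\<close>

text \<open>One index of the sequence is frozen here: all bounds proved in this context are
  non-asymptotic.\<close>

locale dominated_experiment_prior =
  dominated_experiment S \<mu> p + prior: prob_space Q
  for S :: "'s measure" and \<mu> :: "'y measure" and p :: "'s \<Rightarrow> 'y \<Rightarrow> real"
    and Q :: "'s measure" +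
  fixes \<eta>\<^sub>0 :: 's
  assumes sets_prior: "sets Q = sets S"
    and true_parameter: "\<eta>\<^sub>0 \<in> space S"
begin

lemma space_prior: "space Q = space S"
  using sets_prior by (rule sets_eq_imp_space_eq)

lemma measurable_density [measurable]: "case_prod p \<in> borel_measurable (Q \<Otimes>\<^sub>M \<mu>)"
  using joint_measurable sets_prior by (metis measurable_cong_sets sets_pair_measure_cong)

lemma measurable_density_at:
  "\<eta> \<in> space S \<Longrightarrow> p \<eta> \<in> borel_measurable \<mu>"
  using measurable_compose[OF measurable_Pair1' measurable_density, of \<eta>]
  by (simp add: space_prior)

lemma measurable_true_density [measurable]: "p \<eta>\<^sub>0 \<in> borel_measurable \<mu>"
  using true_parameter by (rule measurable_density_at)

sublocale pair: pair_sigma_finite Q \<mu> ..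

lemma prob_space_true_law: "prob_space (experiment_law \<mu> p \<eta>\<^sub>0)"
  using density_total[OF true_parameter]
  by (intro prob_spaceI) (simp add: experiment_law_def emeasure_density cong: nn_integral_cong)

lemma sets_true_law: "sets (experiment_law \<mu> p \<eta>\<^sub>0) = sets \<mu>"
  by (simp add: experiment_law_def)

text \<open>By \<open>Renyi_div_ge_iff\<close> this is a sublevel set of an integral over
  \<open>y\<close> with parameter \<eta>, measurable in \<eta> since the density is jointly
  measurable.\<close>

lemma sets_Renyi_ball:
  assumes "\<alpha> < 1"
  shows "{\<eta> \<in> space S. ereal c \<le> Renyi_div \<alpha> \<mu> (p \<eta>) (p \<eta>\<^sub>0)} \<in> sets Q"
  unfolding Renyi_div_ge_iff[OF assms] space_prior[symmetric] by measurable

section \<open>Tail bounds for the numerator and the denominator of the posterior\<close>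

text \<open>Markov's inequality for the numerator divided by
  \<open>p \<eta>\<^sub>0 y powr \<alpha>\<close>: by Tonelli its mean under the true law is at most
  the \<open>Q\<close>-integral over \<open>A\<close> of quantities bounded by
  \<open>c\<close>.\<close>

lemma numerator_tail:
  fixes \<alpha> c k :: real
  assumes k: "0 < k"
    and A [measurable]: "A \<in> sets Q"
    and H: "\<And>\<eta>. \<eta> \<in> A \<Longrightarrow> (\<integral>\<^sup>+ y. ennreal (p \<eta> y powr \<alpha> * p \<eta>\<^sub>0 y powr (1 - \<alpha>)) \<partial>\<mu>) \<le> ennreal c"
    and c: "0 \<le> c"
  defines "F \<equiv> {y \<in> space \<mu>. ennreal (k * p \<eta>\<^sub>0 y powr \<alpha>) \<le> (\<integral>\<^sup>+ \<eta>\<in>A. ennreal (p \<eta> y powr \<alpha>) \<partial>Q)}"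
  shows "F \<in> sets \<mu>" and "measure (experiment_law \<mu> p \<eta>\<^sub>0) F \<le> c / k"
proof -
  interpret P: prob_space "experiment_law \<mu> p \<eta>\<^sub>0" by (rule prob_space_true_law)
  show F [measurable]: "F \<in> sets \<mu>" unfolding F_def by measurable
  let ?N = "\<lambda>y. \<integral>\<^sup>+ \<eta>\<in>A. ennreal (p \<eta> y powr \<alpha>) \<partial>Q"
  \<comment> \<open>The factor \<open>p \<eta>\<^sub>0 y powr (1 - \<alpha>)\<close> stands in for
    dividing by \<open>p \<eta>\<^sub>0 y powr \<alpha>\<close>. Where the true density vanishes,
    \<open>F\<close> holds trivially, but both sides are 0.\<close>
  have pt: "ennreal k * (ennreal (p \<eta>\<^sub>0 y) * indicator F y) \<le> ennreal (p \<eta>\<^sub>0 y powr (1 - \<alpha>)) * ?N y" for y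
  proof (cases "y \<in> F")
    case True
    then have y: "y \<in> space \<mu>" by (simp add: F_def)
    have "p \<eta>\<^sub>0 y = p \<eta>\<^sub>0 y powr (1 - \<alpha>) * p \<eta>\<^sub>0 y powr \<alpha>"
      using density_nonneg[OF true_parameter y] by (simp add: powr_add[symmetric])
    then have "k * p \<eta>\<^sub>0 y = p \<eta>\<^sub>0 y powr (1 - \<alpha>) * (k * p \<eta>\<^sub>0 y powr \<alpha>)"
      by (metis mult.left_commute)
    from arg_cong[OF this, of ennreal]
    have "ennreal k * ennreal (p \<eta>\<^sub>0 y) = ennreal (p \<eta>\<^sub>0 y powr (1 - \<alpha>)) * ennreal (k * p \<eta>\<^sub>0 y powr \<alpha>)"
      using k by (simp add: ennreal_mult')
    also have "\<dots> \<le> ennreal (p \<eta>\<^sub>0 y powr (1 - \<alpha>)) * ?N y"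
      using True by (intro mult_left_mono) (auto simp: F_def)
    finally show ?thesis using True by simp
  qed simp
  have "ennreal k * emeasure (experiment_law \<mu> p \<eta>\<^sub>0) F
      = (\<integral>\<^sup>+ y. ennreal k * (ennreal (p \<eta>\<^sub>0 y) * indicator F y) \<partial>\<mu>)"
    by (simp add: experiment_law_def emeasure_density nn_integral_cmult)
  also have "\<dots> \<le> (\<integral>\<^sup>+ y. ennreal (p \<eta>\<^sub>0 y powr (1 - \<alpha>)) * ?N y \<partial>\<mu>)"
    by (intro nn_integral_mono pt)
  also have "\<dots> = (\<integral>\<^sup>+ y. \<integral>\<^sup>+ \<eta>. ennreal (p \<eta> y powr \<alpha> * p \<eta>\<^sub>0 y powr (1 - \<alpha>)) * indicator A \<eta> \<partial>Q \<partial>\<mu>)"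
    by (intro nn_integral_cong)
      (simp add: nn_integral_cmult[symmetric] ennreal_mult mult.assoc mult.left_commute)
  also have "\<dots> = (\<integral>\<^sup>+ \<eta>. \<integral>\<^sup>+ y. ennreal (p \<eta> y powr \<alpha> * p \<eta>\<^sub>0 y powr (1 - \<alpha>)) * indicator A \<eta> \<partial>\<mu> \<partial>Q)"
    by (rule pair.Fubini') measurable
  also have "\<dots> \<le> (\<integral>\<^sup>+ \<eta>. ennreal c \<partial>Q)"
  proof (intro nn_integral_mono)
    fix \<eta> assume "\<eta> \<in> space Q"
    show "(\<integral>\<^sup>+ y. ennreal (p \<eta> y powr \<alpha> * p \<eta>\<^sub>0 y powr (1 - \<alpha>)) * indicator A \<eta> \<partial>\<mu>) \<le> ennreal c"
      using H[of \<eta>] by (cases "\<eta> \<in> A") auto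
  qed
  also have "\<dots> = ennreal c"
    by (simp add: prior.emeasure_space_1)
  finally have "ennreal (k * P.prob F) \<le> ennreal c"
    using k by (simp add: P.emeasure_eq_measure ennreal_mult)
  then show "P.prob F \<le> c / k"
    using k c by (simp add: ennreal_le_iff field_simps)
qed

text \<open>
  Jensen's inequality is avoided: instead of averaging \<open>log (p \<eta>\<^sub>0 / p \<eta>)\<close> over \<open>B\<close>, one discards for each
  \<open>y\<close> the parameters with a bad likelihood ratio.  By Tonelli they carry on average only a
  fraction \<open>1 / (4 * m)\<close> of the mass of \<open>B\<close>.
\<close>

lemma denominator_tail:
  fixes \<alpha> m :: real
  assumes \<alpha>: "0 < \<alpha>" and m: "0 < m"
    and B [measurable]: "B \<in> sets Q" and B_pos: "0 < measure Q B"
    and K: "\<And>\<eta>. \<eta> \<in> B \<Longrightarrow> KL \<mu> (p \<eta>\<^sub>0) (p \<eta>) \<le> ereal m"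
    and V: "\<And>\<eta>. \<eta> \<in> B \<Longrightarrow> KL_var \<mu> (p \<eta>\<^sub>0) (p \<eta>) \<le> ereal m"
  obtains F where "F \<in> sets \<mu>" "measure (experiment_law \<mu> p \<eta>\<^sub>0) F \<le> 1 / (2 * m)"
    "\<And>y. y \<in> space \<mu> - F \<Longrightarrow>
      ennreal (measure Q B / 2 * exp (- (3 * \<alpha> * m)) * p \<eta>\<^sub>0 y powr \<alpha>) \<le> (\<integral>\<^sup>+ \<eta>. ennreal (p \<eta> y powr \<alpha>) \<partial>Q)"
proof -
  interpret P: prob_space "experiment_law \<mu> p \<eta>\<^sub>0" by (rule prob_space_true_law)
  define b where "b = measure Q B"
  have b: "0 < b" using B_pos by (simp add: b_def)
  define E where "E = (\<lambda>\<eta> y. p \<eta> y < exp (- (3 * m)) * p \<eta>\<^sub>0 y)"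
  define T where "T = (\<lambda>y. \<integral>\<^sup>+ \<eta>. indicator {\<eta> \<in> B. E \<eta> y} \<eta> \<partial>Q)"
  have [measurable]: "T \<in> borel_measurable \<mu>"
    \<comment> \<open>The set inside the indicator varies with \<open>y\<close>; unfolded, it is a
      predicate jointly measurable in \<eta> and \<open>y\<close>.\<close>
    unfolding T_def E_def indicator_def by measurable
  \<comment> \<open>The level is half the mass of \<open>B\<close>: as \<open>T\<close> has mean at
    most \<open>b / (4 * m)\<close>, Markov gives \<open>F\<close> probability at most
    \<open>1 / (2 * m)\<close>, and off \<open>F\<close> good parameters of mass at least
    \<open>b / 2\<close> remain.\<close>
  define F where "F = {y \<in> space \<mu>. ennreal (b / 2) < T y}"
  have F [measurable]: "F \<in> sets \<mu>" unfolding F_def by measurable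
  have "ennreal (b / 2) * emeasure (experiment_law \<mu> p \<eta>\<^sub>0) F
      = (\<integral>\<^sup>+ y. ennreal (b / 2) * (ennreal (p \<eta>\<^sub>0 y) * indicator F y) \<partial>\<mu>)"
    by (simp add: experiment_law_def emeasure_density nn_integral_cmult)
  also have "\<dots> \<le> (\<integral>\<^sup>+ y. ennreal (p \<eta>\<^sub>0 y) * T y \<partial>\<mu>)"
    by (intro nn_integral_mono)
      (auto simp: F_def mult.commute[of "T _"] mult.commute[of "ennreal (b / 2)"]
        intro!: mult_left_mono split: split_indicator)
  also have "\<dots> = (\<integral>\<^sup>+ y. \<integral>\<^sup>+ \<eta>. ennreal (p \<eta>\<^sub>0 y) * indicator {\<eta> \<in> B. E \<eta> y} \<eta> \<partial>Q \<partial>\<mu>)"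
    unfolding T_def E_def indicator_def
    by (intro nn_integral_cong nn_integral_cmult[symmetric]) measurable
  also have "\<dots> = (\<integral>\<^sup>+ \<eta>. \<integral>\<^sup>+ y. ennreal (p \<eta>\<^sub>0 y) * indicator {\<eta> \<in> B. E \<eta> y} \<eta> \<partial>\<mu> \<partial>Q)"
    unfolding E_def indicator_def by (rule pair.Fubini') measurable
  also have "\<dots> \<le> (\<integral>\<^sup>+ \<eta>. ennreal (1 / (4 * m)) * indicator B \<eta> \<partial>Q)"
  proof (intro nn_integral_mono)
    fix \<eta> assume "\<eta> \<in> space Q"
    show "(\<integral>\<^sup>+ y. ennreal (p \<eta>\<^sub>0 y) * indicator {\<eta> \<in> B. E \<eta> y} \<eta> \<partial>\<mu>)
        \<le> ennreal (1 / (4 * m)) * indicator B \<eta>"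
    proof (cases "\<eta> \<in> B")
      case True
      then have \<eta>: "\<eta> \<in> space S"
        using sets.sets_into_space[OF B] space_prior by auto
      have "(\<integral>\<^sup>+ y. ennreal (p \<eta>\<^sub>0 y) * indicator {\<eta> \<in> B. E \<eta> y} \<eta> \<partial>\<mu>)
          = (\<integral>\<^sup>+ y. ennreal (p \<eta>\<^sub>0 y) * indicator {y. E \<eta> y} y \<partial>\<mu>)"
        using True by (simp add: indicator_def)
      then show ?thesis
        using KL_var_Chebyshev[OF measurable_true_density measurable_density_at[OF \<eta>]
            density_nonneg[OF \<eta>] m K[OF True] V[OF True]] True
        by (simp add: E_def)
    qed simp
  qed
  also have "\<dots> = ennreal (1 / (4 * m)) * emeasure Q B"
    using B by (rule nn_integral_cmult_indicator)
  also have "\<dots> = ennreal (1 / (4 * m) * b)"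
    unfolding b_def prior.emeasure_eq_measure using m by (intro ennreal_mult[symmetric]) auto
  finally have "ennreal (b / 2 * P.prob F) \<le> ennreal (1 / (4 * m) * b)"
    unfolding P.emeasure_eq_measure using b by (subst ennreal_mult) auto
  then have "b / 2 * P.prob F \<le> 1 / (4 * m) * b"
    using b m by (subst (asm) ennreal_le_iff) auto
  then have PF: "P.prob F \<le> 1 / (2 * m)"
    using b m by (simp add: field_simps)
  have "ennreal (b / 2 * exp (- (3 * \<alpha> * m)) * p \<eta>\<^sub>0 y powr \<alpha>) \<le> (\<integral>\<^sup>+ \<eta>. ennreal (p \<eta> y powr \<alpha>) \<partial>Q)"
    if y: "y \<in> space \<mu> - F" for y
  proof -
    have [simp]: "y \<in> space \<mu>" using y by simp
    have [measurable]: "(\<lambda>\<eta>. p \<eta> y) \<in> borel_measurable Q"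
      by measurable
    let ?G = "{\<eta> \<in> B. \<not> E \<eta> y}" and ?E = "{\<eta> \<in> B. E \<eta> y}"
    have "{\<eta> \<in> space Q. \<eta> \<in> B \<and> E \<eta> y} \<in> sets Q" "{\<eta> \<in> space Q. \<eta> \<in> B \<and> \<not> E \<eta> y} \<in> sets Q"
      unfolding E_def by measurable
    moreover have "{\<eta> \<in> space Q. \<eta> \<in> B \<and> E \<eta> y} = ?E" "{\<eta> \<in> space Q. \<eta> \<in> B \<and> \<not> E \<eta> y} = ?G"
      using sets.sets_into_space[OF B] by auto
    ultimately have [measurable]: "?E \<in> sets Q" "?G \<in> sets Q" by auto
    have "ennreal (prior.prob ?E) \<le> ennreal (b / 2)"
      using y by (simp add: F_def T_def prior.emeasure_eq_measure not_less)
    then have "prior.prob ?E \<le> b / 2"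
      using b by (subst (asm) ennreal_le_iff) auto
    moreover have "b = prior.prob ?E + prior.prob ?G"
      unfolding b_def
      by (subst prior.finite_measure_Union[symmetric]) (auto intro!: arg_cong[of _ _ prior.prob])
    ultimately have half: "b / 2 \<le> prior.prob ?G" by simp
    have p0: "0 \<le> p \<eta>\<^sub>0 y" using y density_nonneg[OF true_parameter] by auto
    have "b / 2 * exp (- (3 * \<alpha> * m)) * p \<eta>\<^sub>0 y powr \<alpha>
        \<le> exp (- (3 * \<alpha> * m)) * p \<eta>\<^sub>0 y powr \<alpha> * prior.prob ?G"
      using mult_right_mono[OF half, of "exp (- (3 * \<alpha> * m)) * p \<eta>\<^sub>0 y powr \<alpha>"]
      by (simp add: mult_ac)
    then have "ennreal (b / 2 * exp (- (3 * \<alpha> * m)) * p \<eta>\<^sub>0 y powr \<alpha>)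
        \<le> ennreal (exp (- (3 * \<alpha> * m)) * p \<eta>\<^sub>0 y powr \<alpha>) * emeasure Q ?G"
      by (simp add: prior.emeasure_eq_measure ennreal_mult[symmetric] ennreal_leI)
    also have "\<dots> = (\<integral>\<^sup>+ \<eta>. ennreal (exp (- (3 * \<alpha> * m)) * p \<eta>\<^sub>0 y powr \<alpha>) * indicator ?G \<eta> \<partial>Q)"
      by (rule nn_integral_cmult_indicator[symmetric]) measurable
    also have "\<dots> \<le> (\<integral>\<^sup>+ \<eta>. ennreal (p \<eta> y powr \<alpha>) \<partial>Q)"
    proof (intro nn_integral_mono)
      fix \<eta>
      show "ennreal (exp (- (3 * \<alpha> * m)) * p \<eta>\<^sub>0 y powr \<alpha>) * indicator ?G \<eta> \<le> ennreal (p \<eta> y powr \<alpha>)"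
      proof (cases "\<eta> \<in> ?G")
        case True
        \<comment> \<open>The power \<alpha> of the good-ratio bound turns
          \<open>exp (- (3 * m))\<close> into \<open>exp (- (3 * \<alpha> * m))\<close>.\<close>
        have "exp (- (3 * \<alpha> * m)) * p \<eta>\<^sub>0 y powr \<alpha> = (exp (- (3 * m)) * p \<eta>\<^sub>0 y) powr \<alpha>"
          using p0 by (simp add: powr_mult exp_powr_real mult_ac)
        also have "\<dots> \<le> p \<eta> y powr \<alpha>"
          using True p0 \<alpha> by (intro powr_mono2) (auto simp: E_def)
        finally show ?thesis using True by (simp add: ennreal_leI)
      qed simp
    qed
    finally show ?thesis .
  qed
  with that[OF F PF] show thesis by (simp add: b_def)
qed

section \<open>Finite-sample bound for the posterior\<close>

text \<open>Outside two exceptional events the numerator is at most \<delta> times the denominator.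
  The first summand bounds the event of a large numerator, the second that of a small
  denominator.\<close>

lemma alpha_posterior_tail:
  fixes \<alpha> m \<delta> :: real
  assumes \<alpha>: "0 < \<alpha>" "\<alpha> < 1" and m: "0 < m" and \<delta>: "0 < \<delta>"
    and B_mass: "exp (- (\<alpha> * m)) \<le> measure Q B"
    and K: "\<And>\<eta>. \<eta> \<in> B \<Longrightarrow> KL \<mu> (p \<eta>\<^sub>0) (p \<eta>) \<le> ereal m"
    and V: "\<And>\<eta>. \<eta> \<in> B \<Longrightarrow> KL_var \<mu> (p \<eta>\<^sub>0) (p \<eta>) \<le> ereal m"
  defines "A \<equiv> {\<eta> \<in> space S. ereal (5 * (\<alpha> * m) / (1 - \<alpha>)) \<le> Renyi_div \<alpha> \<mu> (p \<eta>) (p \<eta>\<^sub>0)}"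
  shows "measure (experiment_law \<mu> p \<eta>\<^sub>0) {y \<in> space \<mu>. \<delta> < alpha_posterior \<alpha> Q p y A}
           \<le> 2 * exp (- (\<alpha> * m)) / \<delta> + 1 / (2 * m)"
proof -
  interpret P: prob_space "experiment_law \<mu> p \<eta>\<^sub>0" by (rule prob_space_true_law)
  have B_pos: "0 < measure Q B"
    using B_mass exp_gt_zero by (rule less_le_trans[rotated])
  \<comment> \<open>A set outside the sigma-algebra has \<open>measure\<close> 0, so positive mass
    already makes \<open>B\<close> measurable.\<close>
  then have B: "B \<in> sets Q"
    using measure_notin_sets by fastforce
  obtain F where F: "F \<in> sets \<mu>" "P.prob F \<le> 1 / (2 * m)"
    and D: "\<And>y. y \<in> space \<mu> - F \<Longrightarrow>
      ennreal (measure Q B / 2 * exp (- (3 * \<alpha> * m)) * p \<eta>\<^sub>0 y powr \<alpha>) \<le> (\<integral>\<^sup>+ \<eta>. ennreal (p \<eta> y powr \<alpha>) \<partial>Q)"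
    using denominator_tail[OF \<alpha>(1) m B B_pos K V] by blast
  \<comment> \<open>The guaranteed size of the denominator relative to
    \<open>p \<eta>\<^sub>0 y powr \<alpha>\<close>: one \<alpha>m in the exponent for the mass of
    \<open>B\<close>, three for the likelihood ratio, and half of \<open>B\<close> lost.\<close>
  define k where "k = exp (- (4 * (\<alpha> * m))) / 2"
  have k: "0 < k" by (simp add: k_def)
  have "k = exp (- (\<alpha> * m)) / 2 * exp (- (3 * \<alpha> * m))"
    by (simp add: k_def exp_add[symmetric])
  also have "\<dots> \<le> measure Q B / 2 * exp (- (3 * \<alpha> * m))"
    using B_mass by simp
  finally have k_le: "k \<le> measure Q B / 2 * exp (- (3 * \<alpha> * m))" .
  have A: "A \<in> sets Q"
    unfolding A_def by (rule sets_Renyi_ball[OF \<alpha>(2)])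
  have H: "(\<integral>\<^sup>+ y. ennreal (p \<eta> y powr \<alpha> * p \<eta>\<^sub>0 y powr (1 - \<alpha>)) \<partial>\<mu>) \<le> ennreal (exp (- (5 * (\<alpha> * m))))"
    if "\<eta> \<in> A" for \<eta>
  proof -
    have "(1 - \<alpha>) * (5 * (\<alpha> * m) / (1 - \<alpha>)) = 5 * (\<alpha> * m)"
      using \<alpha> by simp
    with that show ?thesis
      unfolding A_def Renyi_div_ge_iff[OF \<alpha>(2)] by (metis (lifting) mem_Collect_eq)
  qed
  let ?N = "\<lambda>y. \<integral>\<^sup>+ \<eta>\<in>A. ennreal (p \<eta> y powr \<alpha>) \<partial>Q"
  define G where "G = {y \<in> space \<mu>. ennreal (\<delta> * k * p \<eta>\<^sub>0 y powr \<alpha>) \<le> ?N y}"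
  have "0 < \<delta> * k" using \<delta> k by simp
  note G = numerator_tail[OF this A H, folded G_def, simplified]
  have "{y \<in> space \<mu>. \<delta> < alpha_posterior \<alpha> Q p y A} \<subseteq> G \<union> F"
  proof (intro subsetI, rule ccontr)
    fix y assume y: "y \<in> {y \<in> space \<mu>. \<delta> < alpha_posterior \<alpha> Q p y A}" and nin: "y \<notin> G \<union> F"
    let ?D = "\<integral>\<^sup>+ \<eta>. ennreal (p \<eta> y powr \<alpha>) \<partial>Q"
    have "?N y \<le> ennreal (\<delta> * k * p \<eta>\<^sub>0 y powr \<alpha>)"
      using y nin by (auto simp: G_def)
    also have "\<dots> = ennreal \<delta> * ennreal (k * p \<eta>\<^sub>0 y powr \<alpha>)"
      using \<delta> k by (simp add: ennreal_mult[symmetric] mult.assoc)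
    also have "\<dots> \<le> ennreal \<delta> * ?D"
      using y nin k_le
      by (intro mult_left_mono order_trans[OF _ D] ennreal_leI mult_right_mono) auto
    finally have N: "?N y \<le> ennreal \<delta> * ?D" .
    \<comment> \<open>A zero denominator forces a zero numerator, and \<open>0 / 0 = 0\<close>; a
      quotient by an infinite denominator is 0 as well.\<close>
    have "?N y / ?D \<le> ennreal \<delta>"
    proof (cases "?D = 0")
      case True
      with N show ?thesis by simp
    next
      case False
      then show ?thesis
        using N by (cases "?D = \<top>") (simp_all add: divide_le_posI_ennreal mult.commute zero_less_iff_neq_zero)
    qed
    then have "alpha_posterior \<alpha> Q p y A \<le> \<delta>"
      unfolding alpha_posterior_def using \<delta> by (intro enn2real_leI) auto
    then show False using y by simp
  qed
  then have "P.prob {y \<in> space \<mu>. \<delta> < alpha_posterior \<alpha> Q p y A} \<le> P.prob (G \<union> F)"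
    using F(1) G(1) by (intro P.finite_measure_mono) (auto simp: sets_true_law)
  also have "\<dots> \<le> P.prob G + P.prob F"
    using F(1) G(1) by (intro measure_Un_le) (auto simp: sets_true_law)
  also have "\<dots> \<le> exp (- (5 * (\<alpha> * m))) / (\<delta> * k) + 1 / (2 * m)"
    using G(2) F(2) by simp
  also have "exp (- (5 * (\<alpha> * m))) / (\<delta> * k) = 2 * exp (- (\<alpha> * m)) / \<delta>"
  proof -
    have "exp (- (5 * (\<alpha> * m))) = 2 * exp (- (\<alpha> * m)) * k"
      by (simp add: k_def exp_add[symmetric])
    then show ?thesis using k \<delta> by (simp add: field_simps)
  qed
  finally show ?thesis .
qed

end

section \<open>Passage to the limit\<close>

theorem theorem4p1:
  fixes S :: "'s measure" and \<mu> :: "nat \<Rightarrow> 'y measure"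
    and p :: "nat \<Rightarrow> 's \<Rightarrow> 'y \<Rightarrow> real"
    and prior :: "nat \<Rightarrow> 's measure"
    and \<eta>\<^sub>0 :: 's and \<epsilon> \<alpha> :: "nat \<Rightarrow> real"
  assumes "\<And>n. n \<ge> 1 \<Longrightarrow> dominated_experiment S (\<mu> n) (p n)"
    and "\<And>n. n \<ge> 1 \<Longrightarrow> prob_space (prior n)"
    and "\<And>n. n \<ge> 1 \<Longrightarrow> sets (prior n) = sets S"
    and "\<eta>\<^sub>0 \<in> space S"
    and "\<And>n. n \<ge> 1 \<Longrightarrow> \<epsilon> n \<ge> 0"
    and "\<And>n. n \<ge> 1 \<Longrightarrow> 0 < \<alpha> n \<and> \<alpha> n < 1"
    and "filterlim (\<lambda>n. real n * \<alpha> n * (\<epsilon> n)\<^sup>2) at_top sequentially"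
    and "\<And>n. n \<ge> 1 \<Longrightarrow>
           measure (prior n) (KL_nbhd n S (\<mu> n) (p n) \<eta>\<^sub>0 (\<epsilon> n))
             \<ge> exp (- (real n * \<alpha> n * (\<epsilon> n)\<^sup>2))"
  shows "\<exists>C>0. little_o_P_1 (\<lambda>n. experiment_law (\<mu> n) (p n) \<eta>\<^sub>0)
           (\<lambda>n y. alpha_posterior (\<alpha> n) (prior n) (p n) y
              {\<eta> \<in> space S.
                 ereal (1 / real n) * Renyi_div (\<alpha> n) (\<mu> n) (p n \<eta>) (p n \<eta>\<^sub>0)
                   \<ge> ereal (C * (\<alpha> n * (\<epsilon> n)\<^sup>2 / (1 - \<alpha> n)))})"
\<comment> \<open>The denominator uses up four units of \<open>t\<close> in the exponent; the fifth
  leaves the factor \<open>exp (- t n)\<close> that tends to 0.\<close>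
proof (intro exI[of _ 5] conjI)
  define t where "t = (\<lambda>n. real n * \<alpha> n * (\<epsilon> n)\<^sup>2)"
  have t: "filterlim t at_top sequentially"
    using assms(7) by (simp add: t_def)
  let ?A = "\<lambda>n. {\<eta> \<in> space S.
                 ereal (1 / real n) * Renyi_div (\<alpha> n) (\<mu> n) (p n \<eta>) (p n \<eta>\<^sub>0)
                   \<ge> ereal (5 * (\<alpha> n * (\<epsilon> n)\<^sup>2 / (1 - \<alpha> n)))}"
  let ?P = "\<lambda>n. experiment_law (\<mu> n) (p n) \<eta>\<^sub>0"
  show "little_o_P_1 ?P (\<lambda>n y. alpha_posterior (\<alpha> n) (prior n) (p n) y (?A n))"
    unfolding little_o_P_1_def
  proof (intro allI impI)
    fix \<delta> :: real assume \<delta>: "0 < \<delta>"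
    \<comment> \<open>Two conditions hold eventually: \<open>n \<ge> 1\<close>, where the hypotheses
      apply, and \<open>t n > 0\<close>, which makes \<open>m\<close> positive.\<close>
    have "eventually (\<lambda>n. measure (?P n)
        {y \<in> space (?P n). \<delta> < \<bar>alpha_posterior (\<alpha> n) (prior n) (p n) y (?A n)\<bar>}
          \<le> 2 * exp (- t n) / \<delta> + 1 / (2 * t n)) sequentially"
      using eventually_ge_at_top[of 1] filterlim_at_top_dense[THEN iffD1, OF t, rule_format, of 0]
    proof eventually_elim
      case (elim n)
      interpret dominated_experiment_prior S "\<mu> n" "p n" "prior n" \<eta>\<^sub>0
        using assms(1-4) elim(1)
        by (simp add: dominated_experiment_prior_def dominated_experiment_prior_axioms_def)
      define m where "m = real n * (\<epsilon> n)\<^sup>2"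
      have \<alpha>: "0 < \<alpha> n" "\<alpha> n < 1" using assms(6) elim(1) by auto
      have tm: "t n = \<alpha> n * m" by (simp add: t_def m_def)
      have m: "0 < m" using elim(2) \<alpha> by (simp add: tm zero_less_mult_iff)
      \<comment> \<open>Since \<alpha> is below 1, growth of \<open>t\<close> also drives
        \<open>1 / (2 * m)\<close> to 0.\<close>
      have "t n \<le> m" using \<alpha> m by (simp add: tm)
      \<comment> \<open>Multiplying by \<open>n\<close> turns the normalized radius into that of
        \<open>alpha_posterior_tail\<close>, also where the divergence is infinite.\<close>
      have "?A n = {\<eta> \<in> space S. ereal (5 * (\<alpha> n * m) / (1 - \<alpha> n))
          \<le> Renyi_div (\<alpha> n) (\<mu> n) (p n \<eta>) (p n \<eta>\<^sub>0)}"
      proof (intro Collect_cong conj_cong refl)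
        fix \<eta>
        have *: "5 * (\<alpha> n * m) / (1 - \<alpha> n) = 5 * (\<alpha> n * (\<epsilon> n)\<^sup>2 / (1 - \<alpha> n)) * real n"
          by (simp add: m_def)
        have "x \<le> 1 / real n * r \<longleftrightarrow> x * real n \<le> r" for x r :: real
          using elim(1) by (simp add: pos_le_divide_eq)
        then show "ereal (5 * (\<alpha> n * (\<epsilon> n)\<^sup>2 / (1 - \<alpha> n)))
              \<le> ereal (1 / real n) * Renyi_div (\<alpha> n) (\<mu> n) (p n \<eta>) (p n \<eta>\<^sub>0) \<longleftrightarrow>
            ereal (5 * (\<alpha> n * m) / (1 - \<alpha> n)) \<le> Renyi_div (\<alpha> n) (\<mu> n) (p n \<eta>) (p n \<eta>\<^sub>0)"
          unfolding * using elim(1)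
          by (cases "Renyi_div (\<alpha> n) (\<mu> n) (p n \<eta>) (p n \<eta>\<^sub>0)") (simp_all del: times_divide_eq_right times_divide_eq_left)
      qed
      moreover have "space (?P n) = space (\<mu> n)"
        by (simp add: experiment_law_def)
      moreover have "\<bar>alpha_posterior (\<alpha> n) (prior n) (p n) y A\<bar> = alpha_posterior (\<alpha> n) (prior n) (p n) y A"
        for y A by (simp add: alpha_posterior_def)
      moreover have "1 / (2 * m) \<le> 1 / (2 * t n)"
        using \<open>t n \<le> m\<close> elim(2) by (simp add: frac_le)
      moreover have "measure (?P n) {y \<in> space (\<mu> n). \<delta> < alpha_posterior (\<alpha> n) (prior n) (p n) y
            {\<eta> \<in> space S. ereal (5 * (\<alpha> n * m) / (1 - \<alpha> n)) \<le> Renyi_div (\<alpha> n) (\<mu> n) (p n \<eta>) (p n \<eta>\<^sub>0)}}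
          \<le> 2 * exp (- (\<alpha> n * m)) / \<delta> + 1 / (2 * m)"
      proof (rule alpha_posterior_tail[OF \<alpha> m \<delta>])
        show "exp (- (\<alpha> n * m)) \<le> measure (prior n) (KL_nbhd n S (\<mu> n) (p n) \<eta>\<^sub>0 (\<epsilon> n))"
          using assms(8)[OF elim(1)] by (simp add: m_def mult_ac)
      qed (simp_all add: KL_nbhd_def m_def)
      ultimately show ?case
        by (simp add: tm)
    qed
    moreover have "(\<lambda>n. 2 * exp (- t n) / \<delta> + 1 / (2 * t n)) \<longlonglongrightarrow> 0"
    proof -
      have "((\<lambda>x. 2 * exp (- x) / \<delta> + 1 / (2 * x)) \<longlongrightarrow> 0) at_top"
        using \<delta> by real_asymp
      then show ?thesis using t by (rule filterlim_compose)
    qed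
    ultimately show "(\<lambda>n. measure (?P n)
        {y \<in> space (?P n). \<delta> < \<bar>alpha_posterior (\<alpha> n) (prior n) (p n) y (?A n)\<bar>}) \<longlonglongrightarrow> 0"
      by (rule tendsto_sandwich[OF _ _ tendsto_const, rotated]) simp
  qed
qed simp

end
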